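(* Let $p\ge 2$ be a prime and let $\mathcal C=\underline{(\mathbb Z/p^6)\text{-mod}}$ be the classical stable category, endowed with the shift automorphism described in the context. Then the Verdier octahedra $X$ and $\tilde X$ described in the context (which have the same base $\mathbb Z/p^3\xrightarrow{p}\mathbb Z/p^3\xrightarrow{p}\mathbb Z/p^3$) are not isomorphic in $\mathcal C^{+,\mathrm{periodic}}(\bar\Delta_3^\#)$. That is, there is no isomorphism between the restrictions of $X$ and of $\tilde X$ to $\bar\Delta_3^{\triangle\triangledown}$ (as diagrams with values in $\mathcal C$) whose entry at $0^{+1}/i$ is the shift of its entry at $i/0$ for $i=1,2,3$.
   Context: Conventions. Matrices act on row vectors, so the entry in row $r$, column $s$ is the component from the $r$-th summand to the $s$-th summand. Posets. For $n\ge 0$ let $\bar\Delta_n$ be the linearly ordered set of symbols $i^{+z}$ ($0\le i\le n$, $z\in\mathbb Z$), with $i^{+z}\le j^{+w}$ iff $z<w$, or $z=w$ and $i\le j$; write $i$ for $i^{+0}$ and $(i^{+z})^{+w}=i^{+(z+w)}$, $\alpha^{-1}=\alpha^{+(-1)}$. Let $\bar\Delta_n^\#$ be the poset of pairs $\beta/\alpha$ with $\alpha,\beta\in\bar\Delta_n$, $\beta^{-1}\le\alpha\le\beta\le\alpha^{+1}$, ordered componentwise, with shift $(\beta/\alpha)^{+1}=\alpha^{+1}/\beta$. Let $\bar\Delta_n^{\triangle\triangledown}=\{\beta/\alpha\in\bar\Delta_n^\#:0\le\alpha\le\beta\le 0^{+1}\}$. Pretriangles. Let $\mathcal C$ be a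 weakly abelian category (additive; every morphism has a weak kernel and a weak cokernel, is a weak kernel and is a weak cokernel) with an automorphism $X\mapsto X^{+1}$ (shift). A weak square is a commutative quadrangle $A\to B$, $A\to C$, $B\to D$, $C\to D$ such that in the sequence $A\to B\oplus C\to D$ (one sign inserted) the first morphism is a weak kernel of the second and the second a weak cokernel of the first. An $n$-pretriangle is a functor $X:\bar\Delta_n^\#\to\mathcal C$ such that $X_{\alpha/\alpha}$ and $X_{\alpha^{+1}/\alpha}$ are zero for all $\alpha$, and such that for $\delta^{-1}\le\alpha\le\beta\le\gamma\le\delta\le\alpha^{+1}$ the quadrangle $(X_{\gamma/\alpha},X_{\delta/\alpha},X_{\gamma/\beta},X_{\delta/\beta})$ is a weak square. Put $([X]^{+1})_{\beta/\alpha}=X_{(\beta/\alpha)^{+1}}$ and $[X^{+1}]_{\beta/\alpha}=(X_{\beta/\alpha})^{+1}$; likewise for morphisms. $X$ is periodic if $[X]^{+1}=[X^{+1}]$; $\mathcal C^{+,\mathrm{periodic}}(\bar\Delta_n^\#)$ has as objects the periodic $n$-pretriangles and as morphisms those $f$ with $[f]^{+1}=[f^{+1}]$. A Verdier octahedron is a periodic $3$-pretriangle $X$ such that, for every injective map $d:\bar\Delta_2\to\bar\Delta_3$ that preserves $\le$ and commutes with $(-)^{+1}$, the diagram $U_{\beta/\alpha}=X_{\beta d/\alpha d}$ yields a distinguished triangle $U_{1/0}\to U_{2/0}\to U_{2/1}\to U_{0^{+1}/1}=(U_{1/0})^{+1}$. It is known that $X$ and $\tilde X$ below are Verdier octahedra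 with respect to the standard Verdier triangulation of the stable category $\mathcal C$. The category. Let $m=6$. Objects of $\mathcal E=(\mathbb Z/p^m)\text{-mod}$ are the modules $\bigoplus_{i=0}^m(\mathbb Z/p^i)^{\oplus a_i}$, one for each tuple $(a_i)_{0\le i\le m}$ of nonnegative integers; morphisms are $\mathbb Z/p^m$-linear maps. $\mathcal E$ is an abelian Frobenius category; its bijective (i.e. projective and injective) objects are those isomorphic to finite direct sums of copies of $\mathbb Z/p^m$. $\mathcal C=\underline{\mathcal E}$ is the quotient of $\mathcal E$ by the bijective objects. The shift automorphism of $\mathcal C$ is induced by the short exact sequences $\mathbb Z/p^i\xrightarrow{p^{m-i}}\mathbb Z/p^m\xrightarrow{1}\mathbb Z/p^{m-i}$ and their direct sums (the list of cyclic summands of an object is reversed on shifting): on indecomposables $(\mathbb Z/p^i\xrightarrow{a}\mathbb Z/p^j)^{+1}=(\mathbb Z/p^{m-i}\xrightarrow{p^{i-j}a}\mathbb Z/p^{m-j})$, extended to matrices with the order of summands reversed. The morphism $\mathbb Z/p^i\xrightarrow{a}\mathbb Z/p^j$ is zero in $\mathcal C$ iff $p^{\min(m-i,j)}$ divides $a$. The diagrams. A periodic $3$-pretriangle is specified by its restriction to $\bar\Delta_3^{\triangle\triangledown}$. $X$ has $X_{1/0}=X_{2/0}=X_{3/0}=X_{0^{+1}/1}=X_{0^{+1}/2}=X_{0^{+1}/3}=\mathbb Z/p^3$, $X_{2/1}=X_{3/2}=\mathbb Z/p\oplus\mathbb Z/p^5$, $X_{3/1}=\mathbb Z/p^2\oplus\mathbb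 Z/p^4$, and zero at $\alpha/\alpha$ and at $0^{+1}/0$. Its morphisms are: $1/0\to 2/0$, $2/0\to 3/0$, $0^{+1}/1\to 0^{+1}/2$, $0^{+1}/2\to 0^{+1}/3$ are all $p$; $2/0\to 2/1$ is $(1\;\;p^2)$; $3/0\to 3/1$ is $(1\;\;p)$; $2/1\to 3/1$ is $\left(\begin{smallmatrix}p&0\\0&1\end{smallmatrix}\right)$; $3/1\to 3/2$ is $\left(\begin{smallmatrix}1&0\\0&p\end{smallmatrix}\right)$; $3/1\to 0^{+1}/1$ is $\left(\begin{smallmatrix}-p\\1\end{smallmatrix}\right)$; $3/2\to 0^{+1}/2$ is $\left(\begin{smallmatrix}-p^2\\1\end{smallmatrix}\right)$. The diagram $\tilde X$ has the same objects and morphisms, except that $2/1\to 3/1$ is $\left(\begin{smallmatrix}p&0\\1&1\end{smallmatrix}\right)$ and $3/1\to 3/2$ is $\left(\begin{smallmatrix}1&0\\-1&p\end{smallmatrix}\right)$. *)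

theory Defs
  imports "HOL-Algebra.Module" "HOL-Number_Theory.Residues"
begin

section \<open>The category of \<open>\<int>/p\<^sup>m\<close>-modules and its stable category\<close>

text \<open>
  An object is a tuple \<open>[a\<^sub>0, \<dots>, a\<^sub>m]\<close>, standing for the direct sum of the
  \<open>(\<int>/p\<^sup>i)\<^sup>a\<^sup>i\<close>, in this order.  A morphism is a function on module elements; it only
  matters on the carrier of its source, and source and target are always passed separately.
\<close>

type_synonym obj = "nat list"
type_synonym mor = "(nat \<Rightarrow> int) \<Rightarrow> (nat \<Rightarrow> int)"

definition objs :: "nat \<Rightarrow> obj set" where
  "objs m = {A. length A = Suc m}"

text \<open>The exponents \<open>i\<close> of the cyclic summands \<open>\<int>/p\<^sup>i\<close>, with multiplicity, in weakly
  increasing order.\<close>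

definition exps :: "obj \<Rightarrow> nat list" where
  "exps A = concat (map (\<lambda>i. replicate (A ! i) i) [0..<length A])"

definition nsum :: "obj \<Rightarrow> nat" where
  "nsum A = length (exps A)"

text \<open>The order of the \<open>r\<close>-th cyclic summand.\<close>

definition ord_at :: "nat \<Rightarrow> obj \<Rightarrow> nat \<Rightarrow> int" where
  "ord_at p A r = int p ^ (exps A ! r)"

definition CMod :: "nat \<Rightarrow> obj \<Rightarrow> (int, nat \<Rightarrow> int) module" where
  "CMod p A =
    \<lparr> carrier = (\<Pi>\<^sub>E r\<in>{..<nsum A}. {0..<ord_at p A r}),
      monoid.mult = undefined,
      one = undefined,
      zero = (\<lambda>r\<in>{..<nsum A}. 0),
      add = (\<lambda>x y. \<lambda>r\<in>{..<nsum A}. (x r + y r) mod ord_at p A r),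
      smult = (\<lambda>c x. \<lambda>r\<in>{..<nsum A}. (c * x r) mod ord_at p A r) \<rparr>"

definition lin :: "nat \<Rightarrow> nat \<Rightarrow> obj \<Rightarrow> obj \<Rightarrow> mor set" where
  "lin p m A B =
    {f \<in> carrier (CMod p A) \<rightarrow> carrier (CMod p B).
      (\<forall>x\<in>carrier (CMod p A). \<forall>y\<in>carrier (CMod p A).
         f (x \<oplus>\<^bsub>CMod p A\<^esub> y) = f x \<oplus>\<^bsub>CMod p B\<^esub> f y) \<and>
      (\<forall>c\<in>carrier (residue_ring (int p ^ m)). \<forall>x\<in>carrier (CMod p A).
         f (c \<odot>\<^bsub>CMod p A\<^esub> x) = c \<odot>\<^bsub>CMod p B\<^esub> f x)}"

definition zero_mor :: "nat \<Rightarrow> obj \<Rightarrow> mor" where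
  "zero_mor p B = (\<lambda>x. \<zero>\<^bsub>CMod p B\<^esub>)"

text \<open>Isomorphic to a finite direct sum of copies of \<open>\<int>/p\<^sup>m\<close>.\<close>

definition bijective_obj :: "nat \<Rightarrow> nat \<Rightarrow> obj \<Rightarrow> bool" where
  "bijective_obj p m Q \<longleftrightarrow> Q \<in> objs m \<and>
    (\<exists>k. \<exists>f \<in> lin p m Q (replicate m 0 @ [k]). \<exists>g \<in> lin p m (replicate m 0 @ [k]) Q.
       (\<forall>x\<in>carrier (CMod p Q). g (f x) = x) \<and>
       (\<forall>y\<in>carrier (CMod p (replicate m 0 @ [k])). f (g y) = y))"

text \<open>
  Morphisms of the stable category are represented by linear maps; two of them are equal there
  iff their difference factors over a bijective object.
\<close>

definition stab_eq :: "nat \<Rightarrow> nat \<Rightarrow> obj \<Rightarrow> obj \<Rightarrow> mor \<Rightarrow> mor \<Rightarrow> bool" where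
  "stab_eq p m A B f g \<longleftrightarrow>
    (\<exists>Q. bijective_obj p m Q \<and>
      (\<exists>k \<in> lin p m A Q. \<exists>h \<in> lin p m Q B.
        \<forall>x\<in>carrier (CMod p A). f x = g x \<oplus>\<^bsub>CMod p B\<^esub> h (k x)))"

definition stab_zero_obj :: "nat \<Rightarrow> nat \<Rightarrow> obj \<Rightarrow> bool" where
  "stab_zero_obj p m A \<longleftrightarrow> stab_eq p m A A id (zero_mor p A)"

definition stab_iso :: "nat \<Rightarrow> nat \<Rightarrow> obj \<Rightarrow> obj \<Rightarrow> mor \<Rightarrow> bool" where
  "stab_iso p m A B f \<longleftrightarrow> f \<in> lin p m A B \<and>
    (\<exists>g \<in> lin p m B A. stab_eq p m A A (g \<circ> f) id \<and> stab_eq p m B B (f \<circ> g) id)"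

text \<open>Matrices act on row vectors from the right: row \<open>r\<close> belongs to the \<open>r\<close>-th summand
  of the source, column \<open>s\<close> to the \<open>s\<close>-th summand of the target.\<close>

definition mat_mor :: "nat \<Rightarrow> obj \<Rightarrow> obj \<Rightarrow> (nat \<Rightarrow> nat \<Rightarrow> int) \<Rightarrow> mor" where
  "mat_mor p A B M = (\<lambda>x. \<lambda>s\<in>{..<nsum B}. (\<Sum>r<nsum A. x r * M r s) mod ord_at p B s)"

definition entry :: "nat \<Rightarrow> obj \<Rightarrow> mor \<Rightarrow> nat \<Rightarrow> nat \<Rightarrow> int" where
  "entry p A f r s =
    f (\<lambda>t\<in>{..<nsum A}. if t = r then 1 mod ord_at p A r else 0) s"

text \<open>
  The shift automorphism.  On objects \<open>\<int>/p\<^sup>i\<close> becomes \<open>\<int>/p\<^sup>m\<^sup>-\<^sup>i\<close>, so the tuple is reversed.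
  On morphisms, \<open>a : \<int>/p\<^sup>i \<rightarrow> \<int>/p\<^sup>j\<close> becomes \<open>p\<^sup>i\<^sup>-\<^sup>j a\<close>, where the division is exact because
  \<open>p\<^sup>j\<close> divides \<open>p\<^sup>i a\<close>; the order of the summands is reversed as well.
\<close>

definition shift_obj :: "obj \<Rightarrow> obj" where
  "shift_obj A = rev A"

definition shift_mor :: "nat \<Rightarrow> obj \<Rightarrow> obj \<Rightarrow> mor \<Rightarrow> mor" where
  "shift_mor p A B f =
    mat_mor p (shift_obj A) (shift_obj B)
      (\<lambda>r' s'. let r = nsum A - 1 - r'; s = nsum B - 1 - s'
               in (ord_at p A r * entry p A f r s) div ord_at p B s)"

text \<open>
  The conditions on \<open>A \<rightarrow> B \<oplus> C \<rightarrow> D\<close> (weak kernel and weak cokernel) are spelled out in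
  components: a morphism \<open>T \<rightarrow> B \<oplus> C\<close> with zero composite to \<open>D\<close> is a pair of morphisms
  to \<open>B\<close> and \<open>C\<close> with equal composites to \<open>D\<close>, by the sign inserted; dually for \<open>B \<oplus> C \<rightarrow> T\<close>.
\<close>

definition weak_square ::
  "nat \<Rightarrow> nat \<Rightarrow> obj \<Rightarrow> obj \<Rightarrow> obj \<Rightarrow> obj \<Rightarrow> mor \<Rightarrow> mor \<Rightarrow> mor \<Rightarrow> mor \<Rightarrow> bool" where
  "weak_square p m A B C D ab ac bd cd \<longleftrightarrow>
    stab_eq p m A D (bd \<circ> ab) (cd \<circ> ac) \<and>
    (\<forall>T\<in>objs m. \<forall>b \<in> lin p m T B. \<forall>c \<in> lin p m T C.
       stab_eq p m T D (bd \<circ> b) (cd \<circ> c) \<longrightarrow>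
       (\<exists>a \<in> lin p m T A. stab_eq p m T B (ab \<circ> a) b \<and> stab_eq p m T C (ac \<circ> a) c)) \<and>
    (\<forall>T\<in>objs m. \<forall>b \<in> lin p m B T. \<forall>c \<in> lin p m C T.
       stab_eq p m A T (b \<circ> ab) (c \<circ> ac) \<longrightarrow>
       (\<exists>d \<in> lin p m D T. stab_eq p m B T (d \<circ> bd) b \<and> stab_eq p m C T (d \<circ> cd) c))"


section \<open>The posets\<close>

text \<open>\<open>Sym i z\<close> is the symbol \<open>i\<^sup>+\<^sup>z\<close>.\<close>

datatype bd = Sym nat int

instantiation bd :: linorder
begin

fun less_eq_bd :: "bd \<Rightarrow> bd \<Rightarrow> bool" where
  "less_eq_bd (Sym i z) (Sym j w) \<longleftrightarrow> z < w \<or> (z = w \<and> i \<le> j)"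

definition less_bd :: "bd \<Rightarrow> bd \<Rightarrow> bool" where
  "less_bd a b \<longleftrightarrow> a \<le> b \<and> \<not> b \<le> a"

instance
proof
  fix a b c :: bd
  show "(a < b) = (a \<le> b \<and> \<not> b \<le> a)" by (rule less_bd_def)
  show "a \<le> a" by (cases a) simp
  show "a \<le> b \<Longrightarrow> b \<le> c \<Longrightarrow> a \<le> c" by (cases a; cases b; cases c) auto
  show "a \<le> b \<Longrightarrow> b \<le> a \<Longrightarrow> a = b" by (cases a; cases b) auto
  show "a \<le> b \<or> b \<le> a" by (cases a; cases b) auto
qed

end

fun sh :: "int \<Rightarrow> bd \<Rightarrow> bd" where
  "sh w (Sym i z) = Sym i (z + w)"

definition Delta :: "nat \<Rightarrow> bd set" where
  "Delta n = {Sym i z | i z. i \<le> n}"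

text \<open>The pair \<open>(\<beta>, \<alpha>)\<close> is \<open>\<beta>/\<alpha>\<close>.\<close>

type_synonym quo = "bd \<times> bd"

definition Sharp :: "nat \<Rightarrow> quo set" where
  "Sharp n = {(\<beta>, \<alpha>). \<alpha> \<in> Delta n \<and> \<beta> \<in> Delta n \<and> sh (-1) \<beta> \<le> \<alpha> \<and> \<alpha> \<le> \<beta> \<and> \<beta> \<le> sh 1 \<alpha>}"

definition qle :: "quo \<Rightarrow> quo \<Rightarrow> bool" where
  "qle x y \<longleftrightarrow> fst x \<le> fst y \<and> snd x \<le> snd y"

definition qshift :: "quo \<Rightarrow> quo" where
  "qshift x = (sh 1 (snd x), fst x)"

definition Region :: "nat \<Rightarrow> quo set" where
  "Region n = {(\<beta>, \<alpha>). (\<beta>, \<alpha>) \<in> Sharp n \<and> Sym 0 0 \<le> \<alpha> \<and> \<alpha> \<le> \<beta> \<and> \<beta> \<le> Sym 0 1}"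


section \<open>Diagrams and pretriangles\<close>

record diagram =
  Ob :: "quo \<Rightarrow> obj"
  Ar :: "quo \<Rightarrow> quo \<Rightarrow> mor"

definition functor_on :: "nat \<Rightarrow> nat \<Rightarrow> quo set \<Rightarrow> diagram \<Rightarrow> bool" where
  "functor_on p m S X \<longleftrightarrow>
    (\<forall>x\<in>S. Ob X x \<in> objs m) \<and>
    (\<forall>x\<in>S. \<forall>y\<in>S. qle x y \<longrightarrow> Ar X x y \<in> lin p m (Ob X x) (Ob X y)) \<and>
    (\<forall>x\<in>S. stab_eq p m (Ob X x) (Ob X x) (Ar X x x) id) \<and>
    (\<forall>x\<in>S. \<forall>y\<in>S. \<forall>z\<in>S. qle x y \<and> qle y z \<longrightarrow>
       stab_eq p m (Ob X x) (Ob X z) (Ar X y z \<circ> Ar X x y) (Ar X x z))"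

definition natural_on ::
  "nat \<Rightarrow> nat \<Rightarrow> quo set \<Rightarrow> diagram \<Rightarrow> diagram \<Rightarrow> (quo \<Rightarrow> mor) \<Rightarrow> bool" where
  "natural_on p m S X Y f \<longleftrightarrow>
    (\<forall>x\<in>S. f x \<in> lin p m (Ob X x) (Ob Y x)) \<and>
    (\<forall>x\<in>S. \<forall>y\<in>S. qle x y \<longrightarrow>
       stab_eq p m (Ob X x) (Ob Y y) (Ar Y x y \<circ> f x) (f y \<circ> Ar X x y))"

definition pretriangle :: "nat \<Rightarrow> nat \<Rightarrow> nat \<Rightarrow> diagram \<Rightarrow> bool" where
  "pretriangle p m n X \<longleftrightarrow>
    functor_on p m (Sharp n) X \<and>
    (\<forall>\<alpha>\<in>Delta n. stab_zero_obj p m (Ob X (\<alpha>, \<alpha>)) \<and> stab_zero_obj p m (Ob X (sh 1 \<alpha>, \<alpha>))) \<and>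
    (\<forall>\<alpha>\<in>Delta n. \<forall>\<beta>\<in>Delta n. \<forall>\<gamma>\<in>Delta n. \<forall>\<delta>\<in>Delta n.
       sh (-1) \<delta> \<le> \<alpha> \<and> \<alpha> \<le> \<beta> \<and> \<beta> \<le> \<gamma> \<and> \<gamma> \<le> \<delta> \<and> \<delta> \<le> sh 1 \<alpha> \<longrightarrow>
       weak_square p m
         (Ob X (\<gamma>, \<alpha>)) (Ob X (\<delta>, \<alpha>)) (Ob X (\<gamma>, \<beta>)) (Ob X (\<delta>, \<beta>))
         (Ar X (\<gamma>, \<alpha>) (\<delta>, \<alpha>)) (Ar X (\<gamma>, \<alpha>) (\<gamma>, \<beta>))
         (Ar X (\<delta>, \<alpha>) (\<delta>, \<beta>)) (Ar X (\<gamma>, \<beta>) (\<delta>, \<beta>)))"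

definition periodic_pretriangle :: "nat \<Rightarrow> nat \<Rightarrow> nat \<Rightarrow> diagram \<Rightarrow> bool" where
  "periodic_pretriangle p m n X \<longleftrightarrow>
    pretriangle p m n X \<and>
    (\<forall>x\<in>Sharp n. Ob X (qshift x) = shift_obj (Ob X x)) \<and>
    (\<forall>x\<in>Sharp n. \<forall>y\<in>Sharp n. qle x y \<longrightarrow>
       stab_eq p m (Ob X (qshift x)) (Ob X (qshift y))
         (Ar X (qshift x) (qshift y)) (shift_mor p (Ob X x) (Ob X y) (Ar X x y)))"

definition periodic_morphism ::
  "nat \<Rightarrow> nat \<Rightarrow> nat \<Rightarrow> diagram \<Rightarrow> diagram \<Rightarrow> (quo \<Rightarrow> mor) \<Rightarrow> bool" where
  "periodic_morphism p m n X Y f \<longleftrightarrow>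
    natural_on p m (Sharp n) X Y f \<and>
    (\<forall>x\<in>Sharp n.
       stab_eq p m (Ob X (qshift x)) (Ob Y (qshift x))
         (f (qshift x)) (shift_mor p (Ob X x) (Ob Y x) (f x)))"

definition periodic_isomorphic :: "nat \<Rightarrow> nat \<Rightarrow> nat \<Rightarrow> diagram \<Rightarrow> diagram \<Rightarrow> bool" where
  "periodic_isomorphic p m n X Y \<longleftrightarrow>
    (\<exists>f g. periodic_morphism p m n X Y f \<and> periodic_morphism p m n Y X g \<and>
      (\<forall>x\<in>Sharp n. stab_eq p m (Ob X x) (Ob X x) (g x \<circ> f x) id \<and>
                   stab_eq p m (Ob Y x) (Ob Y x) (f x \<circ> g x) id))"

definition iso_on ::
  "nat \<Rightarrow> nat \<Rightarrow> quo set \<Rightarrow> diagram \<Rightarrow> diagram \<Rightarrow> (quo \<Rightarrow> mor) \<Rightarrow> bool" where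
  "iso_on p m S X Y f \<longleftrightarrow>
    natural_on p m S X Y f \<and> (\<forall>x\<in>S. stab_iso p m (Ob X x) (Ob Y x) (f x))"

text \<open>\<open>X\<close> and \<open>D\<close> agree on \<open>S\<close> as diagrams with values in the stable category.\<close>

definition agree_on :: "nat \<Rightarrow> nat \<Rightarrow> quo set \<Rightarrow> diagram \<Rightarrow> diagram \<Rightarrow> bool" where
  "agree_on p m S X D \<longleftrightarrow>
    (\<forall>x\<in>S. Ob X x = Ob D x) \<and>
    (\<forall>x\<in>S. \<forall>y\<in>S. qle x y \<longrightarrow>
       stab_eq p m (Ob X x) (Ob X y) (Ar X x y) (Ar D x y))"


section \<open>The two octahedra\<close>

abbreviation s0 :: bd where "s0 \<equiv> Sym 0 0"
abbreviation s1 :: bd where "s1 \<equiv> Sym 1 0"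
abbreviation s2 :: bd where "s2 \<equiv> Sym 2 0"
abbreviation s3 :: bd where "s3 \<equiv> Sym 3 0"
abbreviation s0' :: bd where "s0' \<equiv> Sym 0 1"

text \<open>The direct sum of the \<open>\<int>/p\<^sup>i\<close>, \<open>i\<close> ranging over a list, for \<open>m = 6\<close>.\<close>

definition dsum :: "nat list \<Rightarrow> obj" where
  "dsum es = map (\<lambda>i. count_list es i) [0..<7]"

definition oct_ob :: "quo \<Rightarrow> obj" where
  "oct_ob x =
    (if x \<in> {(s1, s0), (s2, s0), (s3, s0), (s0', s1), (s0', s2), (s0', s3)} then dsum [3]
     else if x \<in> {(s2, s1), (s3, s2)} then dsum [1, 5]
     else if x = (s3, s1) then dsum [2, 4]
     else dsum [])"

text \<open>The arrows of \<open>Region 3\<close> between neighbours with nonzero source and target, with their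
  matrices; \<open>U\<close> and \<open>V\<close> are the matrices at \<open>2/1 \<rightarrow> 3/1\<close> and \<open>3/1 \<rightarrow> 3/2\<close>.\<close>

definition oct_arrows ::
  "nat \<Rightarrow> int list list \<Rightarrow> int list list \<Rightarrow> ((quo \<times> quo) \<times> int list list) list" where
  "oct_arrows p U V =
    [(((s1, s0), (s2, s0)), [[int p]]),
     (((s2, s0), (s3, s0)), [[int p]]),
     (((s0', s1), (s0', s2)), [[int p]]),
     (((s0', s2), (s0', s3)), [[int p]]),
     (((s2, s0), (s2, s1)), [[1, int p ^ 2]]),
     (((s3, s0), (s3, s1)), [[1, int p]]),
     (((s2, s1), (s3, s1)), U),
     (((s3, s1), (s3, s2)), V),
     (((s3, s1), (s0', s1)), [[- int p], [1]]),
     (((s3, s2), (s0', s2)), [[- (int p ^ 2)], [1]])]"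

definition oct_step :: "nat \<Rightarrow> int list list \<Rightarrow> int list list \<Rightarrow> quo \<Rightarrow> quo \<Rightarrow> mor" where
  "oct_step p U V x y =
    (case map_of (oct_arrows p U V) (x, y) of
       Some M \<Rightarrow> mat_mor p (oct_ob x) (oct_ob y) (\<lambda>r s. M ! r ! s)
     | None \<Rightarrow> zero_mor p (oct_ob y))"

fun along :: "(quo \<Rightarrow> quo \<Rightarrow> mor) \<Rightarrow> quo list \<Rightarrow> mor" where
  "along a [] = id"
| "along a [x] = id"
| "along a (x # y # zs) = along a (y # zs) \<circ> a x y"

text \<open>The path \<open>\<beta>/\<alpha> \<rightarrow> \<dots> \<rightarrow> \<delta>/\<alpha> \<rightarrow> \<dots> \<rightarrow> \<delta>/\<gamma>\<close> through neighbours in \<open>Region 3\<close>.\<close>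

definition oct_path :: "quo \<Rightarrow> quo \<Rightarrow> quo list" where
  "oct_path x y =
    (case (x, y) of ((\<beta>, \<alpha>), (\<delta>, \<gamma>)) \<Rightarrow>
       map (\<lambda>\<xi>. (\<xi>, \<alpha>)) (filter (\<lambda>\<xi>. \<beta> \<le> \<xi> \<and> \<xi> \<le> \<delta>) [s0, s1, s2, s3, s0']) @
       map (\<lambda>\<xi>. (\<delta>, \<xi>)) (filter (\<lambda>\<xi>. \<alpha> < \<xi> \<and> \<xi> \<le> \<gamma>) [s0, s1, s2, s3, s0']))"

text \<open>A diagram on \<open>Region 3\<close>; the arrows that are not listed are composites of arrows between
  neighbours.\<close>

definition oct :: "nat \<Rightarrow> int list list \<Rightarrow> int list list \<Rightarrow> diagram" where
  "oct p U V = \<lparr> Ob = oct_ob, Ar = (\<lambda>x y. along (oct_step p U V) (oct_path x y)) \<rparr>"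

definition octX :: "nat \<Rightarrow> diagram" where
  "octX p = oct p [[int p, 0], [0, 1]] [[1, 0], [0, int p]]"

definition octXt :: "nat \<Rightarrow> diagram" where
  "octXt p = oct p [[int p, 0], [1, 1]] [[1, 0], [-1, int p]]"

end

theory Submission
  imports Defs
begin

text \<open>
  Let \<open>a\<^sub>i\<close> be the entry of an isomorphism at \<open>i/0\<close>, and let \<open>A\<close>, \<open>C\<close> be its matrices at \<open>2/1\<close>
  and \<open>3/1\<close>.  Stably equal maps have entries \<open>\<int>/p\<^sup>i \<rightarrow> \<int>/p\<^sup>j\<close> congruent modulo
  \<open>p\<^sup>k\<close>, \<open>k = min (6 - i) j\<close>.  Naturality at \<open>1/0 \<rightarrow> 2/0 \<rightarrow> 3/0\<close> makes the \<open>a\<^sub>i\<close>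
  congruent modulo \<open>p\<^sup>2\<close>.
  As \<open>p\<^sup>4\<close> divides \<open>A\<^sub>1\<^sub>2\<close>, naturality at \<open>2/1 \<rightarrow> 3/1\<close> forces \<open>p\<^sup>3\<close> to divide \<open>C\<^sub>1\<^sub>2\<close>, whence
  \<open>C\<^sub>2\<^sub>2\<close> is congruent to \<open>a\<^sub>3\<close> modulo \<open>p\<^sup>2\<close> by naturality at \<open>3/0 \<rightarrow> 3/1\<close>.  Periodicity puts \<open>a\<^sub>1\<close> at
  \<open>0\<^sup>+\<^sup>1/1\<close>, and naturality at \<open>3/1 \<rightarrow> 0\<^sup>+\<^sup>1/1\<close> makes \<open>C\<^sub>2\<^sub>2 - p C\<^sub>2\<^sub>1\<close> congruent to \<open>a\<^sub>1\<close> modulo \<open>p\<^sup>2\<close>, so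
  \<open>p\<close> divides \<open>C\<^sub>2\<^sub>1\<close>.  But the additional entry \<open>1\<close> of the second octahedron at \<open>2/1 \<rightarrow> 3/1\<close> makes
  \<open>C\<^sub>2\<^sub>1\<close> congruent to \<open>A\<^sub>2\<^sub>2\<close>, hence to the unit \<open>a\<^sub>2\<close>, modulo \<open>p\<close>.
\<close>

section \<open>Modules, linear maps and their matrix entries\<close>

text \<open>Reducing 1 makes the vector zero at a summand of order 1, so that it lies in the carrier
  in every case.\<close>

definition unit_vec :: "nat \<Rightarrow> obj \<Rightarrow> nat \<Rightarrow> nat \<Rightarrow> int" where
  "unit_vec p A r = (\<lambda>t\<in>{..<nsum A}. if t = r then 1 mod ord_at p A r else 0)"

lemma entry_unit_vec: "entry p A f r s = f (unit_vec p A r) s"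
  by (simp add: entry_def unit_vec_def)

lemma ord_at_pos: "0 < p \<Longrightarrow> 0 < ord_at p A r"
  by (simp add: ord_at_def)

lemma carrier_CMod: "carrier (CMod p A) = (\<Pi>\<^sub>E r\<in>{..<nsum A}. {0..<ord_at p A r})"
  by (simp add: CMod_def)

lemma add_CMod: "x \<oplus>\<^bsub>CMod p A\<^esub> y = (\<lambda>r\<in>{..<nsum A}. (x r + y r) mod ord_at p A r)"
  by (simp add: CMod_def)

lemma smult_CMod: "c \<odot>\<^bsub>CMod p A\<^esub> x = (\<lambda>r\<in>{..<nsum A}. (c * x r) mod ord_at p A r)"
  by (simp add: CMod_def)

lemma zero_CMod: "\<zero>\<^bsub>CMod p A\<^esub> = (\<lambda>r\<in>{..<nsum A}. 0)"
  by (simp add: CMod_def)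

lemma reduced_in_carrier:
  "0 < p \<Longrightarrow> (\<lambda>r\<in>{..<nsum A}. x r mod ord_at p A r) \<in> carrier (CMod p A)"
  by (auto simp: carrier_CMod ord_at_pos)

lemma add_in_carrier: "0 < p \<Longrightarrow> x \<oplus>\<^bsub>CMod p A\<^esub> y \<in> carrier (CMod p A)"
  unfolding add_CMod by (rule reduced_in_carrier)

lemma smult_in_carrier: "0 < p \<Longrightarrow> c \<odot>\<^bsub>CMod p A\<^esub> x \<in> carrier (CMod p A)"
  unfolding smult_CMod by (rule reduced_in_carrier)

lemma zero_in_carrier: "0 < p \<Longrightarrow> \<zero>\<^bsub>CMod p A\<^esub> \<in> carrier (CMod p A)"
  by (auto simp: zero_CMod carrier_CMod ord_at_pos)

lemma unit_vec_in_carrier: "0 < p \<Longrightarrow> unit_vec p A r \<in> carrier (CMod p A)"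
  by (auto simp: unit_vec_def carrier_CMod ord_at_pos)

lemma mat_mor_in_carrier: "0 < p \<Longrightarrow> mat_mor p A B M x \<in> carrier (CMod p B)"
  unfolding mat_mor_def by (rule reduced_in_carrier)

lemma carrier_mod:
  assumes "x \<in> carrier (CMod p A)" "r < nsum A"
  shows "x r mod ord_at p A r = x r"
  using assms by (force simp: carrier_CMod PiE_iff intro: mod_pos_pos_trivial)

lemma carrier_eqI:
  assumes "x \<in> carrier (CMod p A)" "y \<in> carrier (CMod p A)" "\<And>r. r < nsum A \<Longrightarrow> x r = y r"
  shows "x = y"
  using assms unfolding carrier_CMod by (intro PiE_ext) auto

lemma exps_le:
  assumes "A \<in> objs m" "r < nsum A"
  shows "exps A ! r \<le> m"
proof -
  have "exps A ! r \<in> set (exps A)"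
    using assms(2) by (simp add: nsum_def)
  then show ?thesis
    using assms(1) by (auto simp: exps_def objs_def)
qed

text \<open>Every summand has order dividing p^m. Hence compatibility with the scalars of
  \<open>residue_ring\<close>, as demanded in \<open>lin\<close>, extends to all integer
  scalars.\<close>

lemma smult_mod_CMod:
  assumes "A \<in> objs m"
  shows "(c mod int p ^ m) \<odot>\<^bsub>CMod p A\<^esub> x = c \<odot>\<^bsub>CMod p A\<^esub> x"
proof -
  have "((c mod int p ^ m) * x r) mod ord_at p A r = (c * x r) mod ord_at p A r"
    if "r < nsum A" for r
  proof -
    have "ord_at p A r dvd int p ^ m"
      unfolding ord_at_def by (rule le_imp_power_dvd[OF exps_le[OF assms that]])
    then have "(c mod int p ^ m) mod ord_at p A r = c mod ord_at p A r"
      by (rule mod_mod_cancel)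
    then show ?thesis
      by (rule mod_mult_cong) simp
  qed
  then show ?thesis
    unfolding smult_CMod by (intro restrict_ext) auto
qed

lemma lin_closed: "f \<in> lin p m A B \<Longrightarrow> x \<in> carrier (CMod p A) \<Longrightarrow> f x \<in> carrier (CMod p B)"
  unfolding lin_def by auto

lemma lin_add:
  "f \<in> lin p m A B \<Longrightarrow> x \<in> carrier (CMod p A) \<Longrightarrow> y \<in> carrier (CMod p A) \<Longrightarrow>
    f (x \<oplus>\<^bsub>CMod p A\<^esub> y) = f x \<oplus>\<^bsub>CMod p B\<^esub> f y"
  unfolding lin_def by auto

lemma lin_smult:
  assumes "f \<in> lin p m A B" "A \<in> objs m" "B \<in> objs m" "0 < p" "x \<in> carrier (CMod p A)"
  shows "f (c \<odot>\<^bsub>CMod p A\<^esub> x) = c \<odot>\<^bsub>CMod p B\<^esub> f x"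
proof -
  have "c mod int p ^ m \<in> carrier (residue_ring (int p ^ m))"
    using assms(4) by (auto simp: residue_ring_def)
  then have "f ((c mod int p ^ m) \<odot>\<^bsub>CMod p A\<^esub> x) = (c mod int p ^ m) \<odot>\<^bsub>CMod p B\<^esub> f x"
    using assms(1,5) unfolding lin_def by blast
  then show ?thesis
    by (simp add: smult_mod_CMod assms)
qed

lemma lin_comp:
  assumes "f \<in> lin p m A B" "g \<in> lin p m B C"
  shows "g \<circ> f \<in> lin p m A C"
  using assms unfolding lin_def by (auto simp: Pi_iff)

lemma ord_smult_unit_vec:
  assumes "0 < p"
  shows "ord_at p A r \<odot>\<^bsub>CMod p A\<^esub> unit_vec p A r = 0 \<odot>\<^bsub>CMod p A\<^esub> unit_vec p A r"
  unfolding smult_CMod by (intro restrict_ext) (auto simp: unit_vec_def)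

text \<open>The order of a generator kills the generator, hence its image. The zero vector appears
  as a multiple by the scalar 0, so that compatibility with scalars covers it too.\<close>

lemma entry_dvd:
  assumes "f \<in> lin p m A B" "A \<in> objs m" "B \<in> objs m" "0 < p" "s < nsum B"
  shows "ord_at p B s dvd ord_at p A r * entry p A f r s"
proof -
  have "ord_at p A r \<odot>\<^bsub>CMod p B\<^esub> f (unit_vec p A r) = 0 \<odot>\<^bsub>CMod p B\<^esub> f (unit_vec p A r)"
    using lin_smult[OF assms(1-4) unit_vec_in_carrier[OF assms(4)]] ord_smult_unit_vec[OF assms(4)]
    by metis
  from fun_cong[OF this, of s] show ?thesis
    using assms(5) by (simp add: smult_CMod entry_unit_vec dvd_eq_mod_eq_0)
qed

lemma lin_expand:
  assumes "f \<in> lin p m A B" "A \<in> objs m" "B \<in> objs m" "0 < p"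
    and "x \<in> carrier (CMod p A)" "s < nsum B"
  shows "[f x s = (\<Sum>r<nsum A. x r * entry p A f r s)] (mod ord_at p B s)"
proof -
  \<comment> \<open>\<open>trunc n\<close> keeps the first \<open>n\<close> coordinates of
    \<open>x\<close>; each induction step adds a multiple of one unit vector.\<close>
  define trunc where "trunc n = (\<lambda>r\<in>{..<nsum A}. if r < n then x r else 0)" for n
  have trunc_carrier: "trunc n \<in> carrier (CMod p A)" for n
    using assms(5) by (auto simp: trunc_def carrier_CMod ord_at_pos[OF assms(4)] PiE_iff)
  have "[f (trunc n) s = (\<Sum>r<n. x r * entry p A f r s)] (mod ord_at p B s)" if "n \<le> nsum A" for n
    using that
  proof (induction n)
    case 0
    have "trunc 0 = 0 \<odot>\<^bsub>CMod p A\<^esub> x"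
      unfolding trunc_def smult_CMod by (intro restrict_ext) auto
    then have "f (trunc 0) = 0 \<odot>\<^bsub>CMod p B\<^esub> f x"
      using lin_smult[OF assms(1-5)] by simp
    then show ?case
      using assms(6) by (simp add: smult_CMod)
  next
    case (Suc n)
    let ?e = "unit_vec p A n"
    have "trunc (Suc n) = trunc n \<oplus>\<^bsub>CMod p A\<^esub> (x n \<odot>\<^bsub>CMod p A\<^esub> ?e)"
    proof (rule carrier_eqI[OF trunc_carrier add_in_carrier[OF assms(4)]])
      fix r assume r: "r < nsum A"
      show "trunc (Suc n) r = (trunc n \<oplus>\<^bsub>CMod p A\<^esub> (x n \<odot>\<^bsub>CMod p A\<^esub> ?e)) r"
        using r Suc.prems carrier_mod[OF assms(5) r]
        by (auto simp: trunc_def add_CMod smult_CMod unit_vec_def less_Suc_eq mod_mult_right_eq)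
    qed
    then have "f (trunc (Suc n)) = f (trunc n) \<oplus>\<^bsub>CMod p B\<^esub> (x n \<odot>\<^bsub>CMod p B\<^esub> f ?e)"
      using lin_add[OF assms(1) trunc_carrier smult_in_carrier[OF assms(4)]]
        lin_smult[OF assms(1-4) unit_vec_in_carrier[OF assms(4)]] by simp
    then have "f (trunc (Suc n)) s = (f (trunc n) s + x n * entry p A f n s) mod ord_at p B s"
      using assms(6) by (simp add: add_CMod smult_CMod entry_unit_vec mod_add_right_eq)
    then have "[f (trunc (Suc n)) s = f (trunc n) s + x n * entry p A f n s] (mod ord_at p B s)"
      by (simp add: cong_def)
    also have "[f (trunc n) s + x n * entry p A f n s
        = (\<Sum>r<n. x r * entry p A f r s) + x n * entry p A f n s] (mod ord_at p B s)"
      using Suc by (intro cong_add) auto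
    finally show ?case
      by simp
  qed
  moreover have "trunc (nsum A) = x"
    by (rule carrier_eqI[OF trunc_carrier assms(5)]) (simp add: trunc_def)
  ultimately show ?thesis
    by (metis order_refl)
qed

section \<open>Bijective objects and stable equality of entries\<close>

text \<open>In a free module over Z/p^m the elements killed by p^i are the multiples of p^(m-i); the
  isomorphism carries this over to \<open>Q\<close>.\<close>

lemma bijective_obj_divisible:
  assumes "bijective_obj p m Q" "0 < p" "i \<le> m" "x \<in> carrier (CMod p Q)"
    and killed: "int p ^ i \<odot>\<^bsub>CMod p Q\<^esub> x = 0 \<odot>\<^bsub>CMod p Q\<^esub> x"
  obtains y where "y \<in> carrier (CMod p Q)" "x = int p ^ (m - i) \<odot>\<^bsub>CMod p Q\<^esub> y"
proof -
  from assms(1) obtain k \<phi> \<psi> where Q: "Q \<in> objs m"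
    and \<phi>: "\<phi> \<in> lin p m Q (replicate m 0 @ [k])" and \<psi>: "\<psi> \<in> lin p m (replicate m 0 @ [k]) Q"
    and inv: "\<And>x. x \<in> carrier (CMod p Q) \<Longrightarrow> \<psi> (\<phi> x) = x"
    unfolding bijective_obj_def by blast
  define F where "F = replicate m 0 @ [k]"
  note \<phi> = \<phi>[folded F_def] and \<psi> = \<psi>[folded F_def]
  have F: "F \<in> objs m"
    by (simp add: F_def objs_def)
  have "exps F = replicate k m"
    unfolding exps_def F_def by (simp add: nth_append)
  then have ord_F: "ord_at p F t = int p ^ m" if "t < nsum F" for t
    using that by (simp add: ord_at_def nsum_def)
  let ?z = "\<phi> x"
  have z: "?z \<in> carrier (CMod p F)"
    by (rule lin_closed[OF \<phi> assms(4)])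
  have killed_F: "int p ^ i \<odot>\<^bsub>CMod p F\<^esub> ?z = 0 \<odot>\<^bsub>CMod p F\<^esub> ?z"
    using killed lin_smult[OF \<phi> Q F assms(2,4)] by metis
  have pm: "int p ^ m = int p ^ i * int p ^ (m - i)"
    using assms(3) by (simp flip: power_add)
  have dvd: "int p ^ (m - i) dvd ?z t" if "t < nsum F" for t
  proof -
    have "int p ^ m dvd int p ^ i * ?z t"
      using fun_cong[OF killed_F, of t] that by (simp add: smult_CMod ord_F dvd_eq_mod_eq_0)
    then show ?thesis
      using assms(2) by (simp add: pm)
  qed
  \<comment> \<open>The division is exact by \<open>dvd\<close> and keeps the representatives in the
    range of the carrier.\<close>
  define w where "w = (\<lambda>t\<in>{..<nsum F}. ?z t div int p ^ (m - i))"
  have w: "w \<in> carrier (CMod p F)"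
  proof -
    have "0 \<le> ?z t div int p ^ (m - i) \<and> ?z t div int p ^ (m - i) < ord_at p F t"
      if "t < nsum F" for t
    proof -
      have zt: "0 \<le> ?z t" "?z t < ord_at p F t"
        using z that by (auto simp: carrier_CMod PiE_iff)
      then show ?thesis
        using assms(2) zdiv_mono2[of "?z t" 1 "int p ^ (m - i)"]
        by (auto simp: pos_imp_zdiv_nonneg_iff)
    qed
    then show ?thesis
      by (auto simp: w_def carrier_CMod)
  qed
  have "?z = int p ^ (m - i) \<odot>\<^bsub>CMod p F\<^esub> w"
    using dvd carrier_mod[OF z]
    by (intro carrier_eqI[OF z smult_in_carrier[OF assms(2)]]) (simp add: smult_CMod w_def)
  then have "x = int p ^ (m - i) \<odot>\<^bsub>CMod p Q\<^esub> \<psi> w"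
    using lin_smult[OF \<psi> F Q assms(2) w] inv[OF assms(4)] by metis
  with lin_closed[OF \<psi> w] show ?thesis
    using that by blast
qed

text \<open>A unit vector of order \<open>p\<^sup>i\<close> is sent into \<open>p\<^sup>m\<^sup>-\<^sup>i Q\<close> by any map to a bijective object \<open>Q\<close>,
  so the difference of stably equal maps sends it into \<open>p\<^sup>m\<^sup>-\<^sup>i B\<close>.\<close>

lemma stab_eq_entry:
  assumes "stab_eq p m A B f g" "A \<in> objs m" "B \<in> objs m" "0 < p" "r < nsum A" "s < nsum B"
  shows "[entry p A f r s = entry p A g r s] (mod int p ^ min (m - exps A ! r) (exps B ! s))"
proof -
  let ?e = "unit_vec p A r" and ?q = "int p ^ min (m - exps A ! r) (exps B ! s)"
  from assms(1) obtain Q k h where Q: "bijective_obj p m Q"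
    and k: "k \<in> lin p m A Q" and h: "h \<in> lin p m Q B"
    and eq: "\<And>x. x \<in> carrier (CMod p A) \<Longrightarrow> f x = g x \<oplus>\<^bsub>CMod p B\<^esub> h (k x)"
    unfolding stab_eq_def by blast
  have Q_obj: "Q \<in> objs m"
    using Q unfolding bijective_obj_def by blast
  have e: "?e \<in> carrier (CMod p A)"
    by (rule unit_vec_in_carrier[OF assms(4)])
  have "int p ^ (exps A ! r) \<odot>\<^bsub>CMod p Q\<^esub> k ?e = 0 \<odot>\<^bsub>CMod p Q\<^esub> k ?e"
    using ord_smult_unit_vec[OF assms(4), of A r] lin_smult[OF k assms(2) Q_obj assms(4) e]
    unfolding ord_at_def by metis
  then obtain y where y: "y \<in> carrier (CMod p Q)"
      "k ?e = int p ^ (m - exps A ! r) \<odot>\<^bsub>CMod p Q\<^esub> y"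
    using bijective_obj_divisible[OF Q assms(4) exps_le[OF assms(2,5)] lin_closed[OF k e]] by blast
  have "h (k ?e) = int p ^ (m - exps A ! r) \<odot>\<^bsub>CMod p B\<^esub> h y"
    using lin_smult[OF h Q_obj assms(3,4) y(1)] y(2) by metis
  then have "h (k ?e) s = (int p ^ (m - exps A ! r) * h y s) mod ord_at p B s"
    using assms(6) by (simp add: smult_CMod)
  \<comment> \<open>Coordinates in \<open>B\<close> are reduced modulo the order p^j of the target
    summand, hence the minimum with j in the exponent of \<open>?q\<close>.\<close>
  moreover have ord_dvd: "?q dvd ord_at p B s"
    unfolding ord_at_def by (rule le_imp_power_dvd) simp
  moreover have "?q dvd int p ^ (m - exps A ! r)"
    by (rule le_imp_power_dvd) simp
  ultimately have "?q dvd h (k ?e) s"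
    by (simp add: dvd_mod)
  then have "[g ?e s + h (k ?e) s = g ?e s] (mod ?q)"
    by (simp add: cong_iff_dvd_diff)
  moreover have "[f ?e s = g ?e s + h (k ?e) s] (mod ord_at p B s)"
    using eq[OF e] assms(6) by (simp add: add_CMod cong_def)
  ultimately show ?thesis
    unfolding entry_unit_vec using cong_trans cong_dvd_modulus[OF _ ord_dvd] by blast
qed

section \<open>Stable equality and composition\<close>

lemma stab_eq_comp_right:
  assumes "f \<in> lin p m A B" "stab_eq p m B C g g'"
  shows "stab_eq p m A C (g \<circ> f) (g' \<circ> f)"
proof -
  from assms(2) obtain Q k h where "bijective_obj p m Q" "k \<in> lin p m B Q" "h \<in> lin p m Q C"
      "\<forall>x\<in>carrier (CMod p B). g x = g' x \<oplus>\<^bsub>CMod p C\<^esub> h (k x)"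
    unfolding stab_eq_def by blast
  then show ?thesis
    unfolding stab_eq_def using lin_comp[OF assms(1), of k Q] lin_closed[OF assms(1)]
    by (intro exI[of _ Q] conjI bexI[of _ "k \<circ> f"] bexI[of _ h]) auto
qed

text \<open>Additivity of \<open>g\<close> splits off the part through \<open>Q\<close>. For
  \<open>f'\<close> the hypothesis is about values only, because \<open>mat_mor\<close> of an
  arbitrary matrix need not be linear.\<close>

lemma stab_eq_comp_left:
  assumes "g \<in> lin p m B C" "stab_eq p m A B f f'"
    and "\<And>x. x \<in> carrier (CMod p A) \<Longrightarrow> f' x \<in> carrier (CMod p B)"
  shows "stab_eq p m A C (g \<circ> f) (g \<circ> f')"
proof -
  from assms(2) obtain Q k h where *: "bijective_obj p m Q" "k \<in> lin p m A Q" "h \<in> lin p m Q B"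
      "\<forall>x\<in>carrier (CMod p A). f x = f' x \<oplus>\<^bsub>CMod p B\<^esub> h (k x)"
    unfolding stab_eq_def by blast
  have "\<forall>x\<in>carrier (CMod p A). (g \<circ> f) x = (g \<circ> f') x \<oplus>\<^bsub>CMod p C\<^esub> (g \<circ> h) (k x)"
    using * lin_add[OF assms(1)] assms(3) lin_closed[OF *(2)] lin_closed[OF *(3)] by simp
  then show ?thesis
    unfolding stab_eq_def using lin_comp[OF *(3) assms(1)] *(1,2) by blast
qed

lemma zero_mor_lin: "0 < p \<Longrightarrow> zero_mor p B \<in> lin p m A B"
  using zero_in_carrier[of p B] unfolding lin_def zero_mor_def
  by (auto simp: zero_CMod add_CMod smult_CMod intro!: restrict_ext)

lemma stab_eq_refl:
  assumes "0 < p" "\<And>x. x \<in> carrier (CMod p A) \<Longrightarrow> f x \<in> carrier (CMod p B)"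
  shows "stab_eq p m A B f f"
proof -
  \<comment> \<open>The free module of rank 0: the zero difference factors over it.\<close>
  let ?Q = "replicate m 0 @ [0]"
  have exps_Q: "exps ?Q = []"
    by (simp add: exps_def nth_append)
  then have "nsum ?Q = 0"
    by (simp add: nsum_def)
  then have "x = \<zero>\<^bsub>CMod p ?Q\<^esub>" if "x \<in> carrier (CMod p ?Q)" for x
    using that by (simp add: carrier_CMod zero_CMod restrict_def)
  then have "bijective_obj p m ?Q"
    unfolding bijective_obj_def objs_def using zero_mor_lin[OF assms(1), of ?Q m ?Q]
    by (intro conjI exI[of _ 0] bexI[of _ "zero_mor p ?Q"]) (auto simp: zero_mor_def)
  moreover have "f x = f x \<oplus>\<^bsub>CMod p B\<^esub> zero_mor p B (zero_mor p ?Q x)"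
    if "x \<in> carrier (CMod p A)" for x
  proof -
    note fx = assms(2)[OF that]
    show ?thesis
      using carrier_mod[OF fx]
      by (intro carrier_eqI[OF fx add_in_carrier[OF assms(1)]])
        (simp add: add_CMod zero_mor_def zero_CMod)
  qed
  ultimately show ?thesis
    unfolding stab_eq_def using zero_mor_lin[OF assms(1)] by blast
qed

section \<open>Naturality squares as matrix congruences\<close>

lemma entry_comp:
  assumes "g \<in> lin p m B C" "B \<in> objs m" "C \<in> objs m" "0 < p"
    and "f (unit_vec p A r) \<in> carrier (CMod p B)" "s < nsum C"
  shows "[entry p A (g \<circ> f) r s = (\<Sum>t<nsum B. entry p A f r t * entry p B g t s)]
    (mod ord_at p C s)"
  using lin_expand[OF assms(1-6)] by (simp add: entry_unit_vec)

text \<open>At a summand of order 1 the generator is zero and the entry would vanish;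
  \<open>1 < p\<close> and the positive exponent exclude this.\<close>

lemma entry_mat_mor:
  assumes "1 < p" "r < nsum A" "0 < exps A ! r" "s < nsum B"
  shows "entry p A (mat_mor p A B M) r s = M r s mod ord_at p B s"
proof -
  have "1 mod ord_at p A r = 1"
    using assms(1,3) by (auto simp: ord_at_def intro!: mod_pos_pos_trivial)
  then have "unit_vec p A r t * M t s = (if t = r then M r s else 0)" if "t < nsum A" for t
    using that by (auto simp: unit_vec_def)
  then show ?thesis
    using assms(2,4) by (simp add: entry_unit_vec mat_mor_def sum.delta)
qed

text \<open>Up to stable equality each arrow may be replaced by its matrix; both ways round the
  square then become matrix products in the row convention, compared with the modulus of
  \<open>stab_eq_entry\<close>.\<close>

lemma natural_square_entry:
  assumes p: "1 < p"
    and obj: "A \<in> objs m" "B \<in> objs m" "A' \<in> objs m" "B' \<in> objs m"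
    and f: "f \<in> lin p m A A'" and f': "f' \<in> lin p m B B'"
    and a: "stab_eq p m A B a (mat_mor p A B M)"
    and a': "stab_eq p m A' B' a' (mat_mor p A' B' M')"
    and square: "stab_eq p m A B' (a' \<circ> f) (f' \<circ> a)"
    and r: "r < nsum A" "0 < exps A ! r" and s: "s < nsum B'"
  shows "[(\<Sum>t<nsum A'. entry p A f r t * M' t s) = (\<Sum>t<nsum B. M r t * entry p B f' t s)]
    (mod int p ^ min (m - exps A ! r) (exps B' ! s))"
proof -
  let ?q = "int p ^ min (m - exps A ! r) (exps B' ! s)"
  have p0: "0 < p"
    using p by simp
  have ord_dvd: "?q dvd ord_at p B' s"
    unfolding ord_at_def by (rule le_imp_power_dvd) simp
  note cong = stab_eq_entry[OF _ obj(1,4) p0 r(1) s]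
  have "[(\<Sum>t<nsum A'. entry p A f r t * M' t s) = entry p A (mat_mor p A' B' M' \<circ> f) r s]
      (mod ord_at p B' s)"
    using s by (simp add: entry_unit_vec mat_mor_def cong_def)
  note cong_dvd_modulus[OF this ord_dvd]
  also have "[entry p A (mat_mor p A' B' M' \<circ> f) r s = entry p A (a' \<circ> f) r s] (mod ?q)"
    by (rule cong_sym[OF cong[OF stab_eq_comp_right[OF f a']]])
  also have "[entry p A (a' \<circ> f) r s = entry p A (f' \<circ> a) r s] (mod ?q)"
    by (rule cong[OF square])
  also have "[entry p A (f' \<circ> a) r s = entry p A (f' \<circ> mat_mor p A B M) r s] (mod ?q)"
    by (rule cong[OF stab_eq_comp_left[OF f' a mat_mor_in_carrier[OF p0]]])
  also have "[entry p A (f' \<circ> mat_mor p A B M) r s = (\<Sum>t<nsum B. M r t * entry p B f' t s)]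
      (mod ?q)"
  proof -
    have "[entry p A (f' \<circ> mat_mor p A B M) r s
        = (\<Sum>t<nsum B. (M r t mod ord_at p B t) * entry p B f' t s)] (mod ord_at p B' s)"
      using entry_comp[where f = "mat_mor p A B M" and A = A and r = r,
          OF f' obj(2,4) p0 mat_mor_in_carrier[OF p0] s] entry_mat_mor[OF p r]
      by simp
    also have "[(\<Sum>t<nsum B. (M r t mod ord_at p B t) * entry p B f' t s)
        = (\<Sum>t<nsum B. M r t * entry p B f' t s)] (mod ord_at p B' s)"
    proof (intro cong_sum)
      fix t
      \<comment> \<open>Reduction changes \<open>M r t\<close> by a multiple of the order of summand
        \<open>t\<close> of \<open>B\<close>; that order times an entry of \<open>f'\<close> is
        divisible by the order of the target summand.\<close>
      have "(M r t mod ord_at p B t) * entry p B f' t s - M r t * entry p B f' t s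
          = - (M r t div ord_at p B t) * (ord_at p B t * entry p B f' t s)"
        by (simp add: minus_div_mult_eq_mod[symmetric] algebra_simps)
      then show "[(M r t mod ord_at p B t) * entry p B f' t s = M r t * entry p B f' t s]
          (mod ord_at p B' s)"
        unfolding cong_iff_dvd_diff using entry_dvd[OF f' obj(2,4) p0 s] by simp
    qed
    finally show ?thesis
      by (rule cong_dvd_modulus[OF _ ord_dvd])
  qed
  finally show ?thesis .
qed


section \<open>The arrows of the octahedra that enter the argument\<close>

definition used_arrows :: "(quo \<times> quo) set" where
  "used_arrows =
    {((s1, s0), (s2, s0)), ((s2, s0), (s3, s0)), ((s2, s0), (s2, s1)), ((s3, s0), (s3, s1)),
     ((s2, s1), (s3, s1)), ((s3, s1), (s0', s1))}"

lemma used_arrows_Region: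
  "(x, y) \<in> used_arrows \<Longrightarrow> x \<in> Region 3 \<and> y \<in> Region 3 \<and> qle x y"
  by (auto simp: used_arrows_def Region_def Sharp_def Delta_def qle_def)

text \<open>Each of these arrows joins neighbours, so \<open>oct_path\<close> consists of its two
  ends.\<close>

lemma Ar_oct:
  "(x, y) \<in> used_arrows \<Longrightarrow> Ar (oct p U V) x y = oct_step p U V x y"
  by (auto simp: used_arrows_def oct_def oct_path_def less_bd_def)

lemma objs_oct: "oct_ob x \<in> objs 6"
  by (auto simp: oct_ob_def dsum_def objs_def)

lemma exps_dsum:
  "exps (dsum [3]) = [3]" "exps (dsum [1, 5]) = [1, 5]" "exps (dsum [2, 4]) = [2, 4]"
  by (simp_all add: exps_def dsum_def upt_rec numeral_eq_Suc)

lemma shift_dsum_3: "shift_obj (dsum [3]) = dsum [3]"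
  by (simp add: shift_obj_def dsum_def upt_rec numeral_eq_Suc)

lemma Ob_oct [simp]: "Ob (octX p) = oct_ob" "Ob (octXt p) = oct_ob"
  by (simp_all add: octX_def octXt_def oct_def)

lemma oct_ob_simps:
  "oct_ob (s1, s0) = dsum [3]" "oct_ob (s2, s0) = dsum [3]" "oct_ob (s3, s0) = dsum [3]"
  "oct_ob (s0', s1) = dsum [3]" "oct_ob (s2, s1) = dsum [1, 5]" "oct_ob (s3, s1) = dsum [2, 4]"
  by (simp_all add: oct_ob_def)

section \<open>Incompatibility of the congruences\<close>

text \<open>\<open>P\<close> stands for p, \<open>b\<close> for the entry of an inverse at 2/0,
  \<open>c1\<close> for the entry at \<open>0'/1\<close>, where \<open>0'\<close> is the shift of 0.
  The hypotheses \<open>sq1\<close> to \<open>sq7\<close> are naturality at 1/0 -> 2/0, 2/0 -> 3/0,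
  2/0 -> 2/1, 3/0 -> 3/1, twice 2/1 -> 3/1, and 3/1 -> \<open>0'/1\<close>.\<close>

lemma entries_contradiction:
  fixes P a1 a2 a3 c1 A12 A22 A21 C12 C21 C22 b :: int
  assumes P: "prime P"
    and unit: "[a2 * b = 1] (mod P ^ 3)"
    and shift: "[c1 = a1] (mod P ^ 3)"
    and A12: "P ^ 5 dvd P * A12"
    and sq1: "[a1 * P = P * a2] (mod P ^ 3)"
    and sq2: "[a2 * P = P * a3] (mod P ^ 3)"
    and sq3: "[a2 * P ^ 2 = A12 + P ^ 2 * A22] (mod P ^ 3)"
    and sq4: "[a3 * P = C12 + P * C22] (mod P ^ 3)"
    and sq5: "[A12 = P * C12] (mod P ^ 4)"
    and sq6: "[A21 * P + A22 = C21] (mod P)"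
    and sq7: "[C22 - C21 * P = c1] (mod P ^ 2)"
  shows False
proof -
  have P0: "P \<noteq> 0"
    using P by auto
  have "P * P ^ 4 dvd P * A12"
    using A12 by (simp add: eval_nat_numeral)
  then have A12': "P ^ 4 dvd A12"
    using P0 by simp
  then have "P * P ^ 3 dvd P * C12"
    using sq5 by (simp add: cong_dvd_iff eval_nat_numeral)
  then obtain c where c: "C12 = P ^ 3 * c"
    using P0 by (auto elim: dvdE)
  obtain k where k: "A12 = P ^ 4 * k"
    using A12' by (auto elim: dvdE)
  obtain l1 where l1: "a1 * P = P * a2 + P ^ 3 * l1"
    using sq1 by (metis cong_iff_lin cong_sym)
  obtain l2 where l2: "a2 * P = P * a3 + P ^ 3 * l2"
    using sq2 by (metis cong_iff_lin cong_sym)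
  obtain l3 where l3: "a2 * P ^ 2 = A12 + P ^ 2 * A22 + P ^ 3 * l3"
    using sq3 by (metis cong_iff_lin cong_sym)
  obtain l4 where l4: "a3 * P = C12 + P * C22 + P ^ 3 * l4"
    using sq4 by (metis cong_iff_lin cong_sym)
  obtain l6 where l6: "A21 * P + A22 = C21 + P * l6"
    using sq6 by (metis cong_iff_lin cong_sym)
  obtain l7 where l7: "C22 - C21 * P = c1 + P ^ 2 * l7"
    using sq7 by (metis cong_iff_lin cong_sym)
  obtain l8 where l8: "c1 = a1 + P ^ 3 * l8"
    using shift by (metis cong_iff_lin cong_sym)
  \<comment> \<open>Cancelling P leaves \<open>a1\<close>, \<open>a2\<close>, \<open>a3\<close> and
    \<open>C22\<close> congruent modulo P^2; cancelling P^2 leaves \<open>a2\<close> and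
    \<open>A22\<close> congruent modulo P.\<close>
  have "P * a1 = P * (a2 + P ^ 2 * l1)"
    using l1 by (simp add: eval_nat_numeral algebra_simps)
  then have a1: "a1 = a2 + P ^ 2 * l1"
    using P0 by simp
  have "P * a2 = P * (a3 + P ^ 2 * l2)"
    using l2 by (simp add: eval_nat_numeral algebra_simps)
  then have a2: "a2 = a3 + P ^ 2 * l2"
    using P0 by simp
  have "P ^ 2 * a2 = P ^ 2 * (P ^ 2 * k + A22 + P * l3)"
    using l3 k by (simp add: eval_nat_numeral algebra_simps)
  then have a2': "a2 = P ^ 2 * k + A22 + P * l3"
    using P0 by simp
  have "P * a3 = P * (P ^ 2 * c + C22 + P ^ 2 * l4)"
    using l4 c by (simp add: eval_nat_numeral algebra_simps)
  then have a3: "a3 = P ^ 2 * c + C22 + P ^ 2 * l4"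
    using P0 by simp
  \<comment> \<open>Substituting the chain from \<open>a1\<close> down to \<open>C22\<close> into
    \<open>sq7\<close> cancels \<open>C22\<close>; the remaining terms are divisible by P^2.\<close>
  have "P * C21 = P * (P * (- (c + l4 + l1 + l2 + l7 + P * l8)))"
    using l7 l8 a1 a2 a3 by (simp add: eval_nat_numeral algebra_simps)
  then have "C21 = P * (- (c + l4 + l1 + l2 + l7 + P * l8))"
    by (simp only: mult_left_cancel[OF P0])
  then have "a2 = P * (P * k + l3 + l6 - A21 - (c + l4 + l1 + l2 + l7 + P * l8))"
    using a2' l6 by (simp add: eval_nat_numeral algebra_simps)
  then have "P dvd a2 * b"
    by simp
  moreover have "[a2 * b = 1] (mod P)"
    using unit by (rule cong_dvd_modulus) simp
  ultimately show False
    using P by (metis cong_dvd_iff not_prime_unit)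
qed

section \<open>From isomorphisms of diagrams to the congruences\<close>

text \<open>Stated for diagrams that agree stably with the octahedra, so that it serves both for
  periodic pretriangles extending them and for the octahedra themselves.\<close>

lemma no_shift_compatible_iso:
  fixes p :: nat
  assumes p: "prime p"
    and obX: "\<And>x. x \<in> Region 3 \<Longrightarrow> Ob X x = oct_ob x"
    and obY: "\<And>x. x \<in> Region 3 \<Longrightarrow> Ob Y x = oct_ob x"
    and arX: "\<And>x y. (x, y) \<in> used_arrows \<Longrightarrow>
      stab_eq p 6 (oct_ob x) (oct_ob y) (Ar X x y) (Ar (octX p) x y)"
    and arY: "\<And>x y. (x, y) \<in> used_arrows \<Longrightarrow>
      stab_eq p 6 (oct_ob x) (oct_ob y) (Ar Y x y) (Ar (octXt p) x y)"
    and nat: "natural_on p 6 (Region 3) X Y f"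
    and g: "g \<in> lin p 6 (oct_ob (s2, s0)) (oct_ob (s2, s0))"
    and gf: "stab_eq p 6 (oct_ob (s2, s0)) (oct_ob (s2, s0)) (g \<circ> f (s2, s0)) id"
    and shift: "stab_eq p 6 (oct_ob (s0', s1)) (oct_ob (s0', s1)) (f (s0', s1))
      (shift_mor p (oct_ob (s1, s0)) (oct_ob (s1, s0)) (f (s1, s0)))"
  shows False
proof -
  have p1: "1 < p" and p0: "0 < p"
    using prime_gt_1_nat[OF p] by auto
  have Reg: "(s1, s0) \<in> Region 3" "(s2, s0) \<in> Region 3" "(s3, s0) \<in> Region 3"
      "(s2, s1) \<in> Region 3" "(s3, s1) \<in> Region 3" "(s0', s1) \<in> Region 3"
    by (simp_all add: Region_def Sharp_def Delta_def)
  have lin: "f x \<in> lin p 6 (oct_ob x) (oct_ob x)" if "x \<in> Region 3" for x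
    using nat that unfolding natural_on_def by (simp add: obX obY)
  have square: "stab_eq p 6 (oct_ob x) (oct_ob y) (Ar Y x y \<circ> f x) (f y \<circ> Ar X x y)"
    if "(x, y) \<in> used_arrows" for x y
    using nat used_arrows_Region[OF that] unfolding natural_on_def by (metis obX obY)
  have entries: "[(\<Sum>t<nsum (oct_ob x). entry p (oct_ob x) (f x) r t * N ! t ! s) =
        (\<Sum>t<nsum (oct_ob y). M ! r ! t * entry p (oct_ob y) (f y) t s)]
      (mod int p ^ min (6 - exps (oct_ob x) ! r) (exps (oct_ob y) ! s))"
    if xy: "(x, y) \<in> used_arrows"
      and M: "Ar (octX p) x y = mat_mor p (oct_ob x) (oct_ob y) (\<lambda>r s. M ! r ! s)"
      and N: "Ar (octXt p) x y = mat_mor p (oct_ob x) (oct_ob y) (\<lambda>r s. N ! r ! s)"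
      and rs: "r < nsum (oct_ob x)" "0 < exps (oct_ob x) ! r" "s < nsum (oct_ob y)"
    for x y r s M N
    using natural_square_entry[OF p1 objs_oct objs_oct objs_oct objs_oct lin lin
        arX[OF xy, unfolded M] arY[OF xy, unfolded N] square[OF xy] rs] used_arrows_Region[OF xy]
    by blast
  note arrows = used_arrows_def octX_def octXt_def Ar_oct oct_step_def oct_arrows_def
  note sums = oct_ob_simps[unfolded One_nat_def] exps_dsum[unfolded One_nat_def] nsum_def lessThan_Suc
  let ?P = "int p"
  let ?E = "\<lambda>x. entry p (oct_ob x) (f x)"
  \<comment> \<open>The identity has entry 1, so the entries of \<open>f\<close> and of its left
    inverse \<open>g\<close> multiply to 1.\<close>
  have "[?E (s2, s0) 0 0 * entry p (oct_ob (s2, s0)) g 0 0 = 1] (mod ?P ^ 3)"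
  proof -
    note E = stab_eq_entry[OF gf objs_oct objs_oct p0, of 0 0]
    have "f (s2, s0) (unit_vec p (oct_ob (s2, s0)) 0) \<in> carrier (CMod p (oct_ob (s2, s0)))"
      by (rule lin_closed[OF lin[OF Reg(2)] unit_vec_in_carrier[OF p0]])
    note C = entry_comp[where f = "f (s2, s0)" and s = 0, OF g objs_oct objs_oct p0 this]
    have "[entry p (oct_ob (s2, s0)) id 0 0 = 1] (mod ?P ^ 3)"
      by (simp add: entry_def ord_at_def sums cong_def)
    moreover have "[entry p (oct_ob (s2, s0)) (g \<circ> f (s2, s0)) 0 0
        = entry p (oct_ob (s2, s0)) id 0 0] (mod ?P ^ 3)"
      using E by (simp add: sums)
    moreover have "[entry p (oct_ob (s2, s0)) (g \<circ> f (s2, s0)) 0 0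
        = ?E (s2, s0) 0 0 * entry p (oct_ob (s2, s0)) g 0 0] (mod ?P ^ 3)"
      using C by (simp add: ord_at_def sums)
    ultimately show ?thesis
      using cong_trans cong_sym by blast
  qed
  \<comment> \<open>On an endomorphism of Z/p^3 the shift multiplies the entry by p^(3-3) =
    1.\<close>
  moreover have "[?E (s0', s1) 0 0 = ?E (s1, s0) 0 0] (mod ?P ^ 3)"
  proof -
    note E = stab_eq_entry[OF shift objs_oct objs_oct p0, of 0 0]
    have "[entry p (dsum [3]) (shift_mor p (dsum [3]) (dsum [3]) (f (s1, s0))) 0 0
        = entry p (dsum [3]) (f (s1, s0)) 0 0] (mod ?P ^ 3)"
      using entry_mat_mor[OF p1, of 0 "dsum [3]" 0 "dsum [3]"] p0
      by (simp add: shift_mor_def shift_dsum_3 sums ord_at_def Let_def)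
    moreover have "[entry p (dsum [3]) (f (s0', s1)) 0 0
        = entry p (dsum [3]) (shift_mor p (dsum [3]) (dsum [3]) (f (s1, s0))) 0 0] (mod ?P ^ 3)"
      using E by (simp add: sums)
    ultimately show ?thesis
      using cong_trans unfolding oct_ob_simps by blast
  qed
  moreover have "?P ^ 5 dvd ?P * ?E (s2, s1) 0 1"
    using entry_dvd[OF lin[OF Reg(4)] objs_oct objs_oct p0, of 1 0]
    by (simp add: ord_at_def sums)
  moreover have "[?E (s1, s0) 0 0 * ?P = ?P * ?E (s2, s0) 0 0] (mod ?P ^ 3)"
    using entries[of "(s1, s0)" "(s2, s0)" "[[?P]]" "[[?P]]" 0 0]
    by (simp add: arrows) (simp add: sums add.commute)
  moreover have "[?E (s2, s0) 0 0 * ?P = ?P * ?E (s3, s0) 0 0] (mod ?P ^ 3)"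
    using entries[of "(s2, s0)" "(s3, s0)" "[[?P]]" "[[?P]]" 0 0]
    by (simp add: arrows) (simp add: sums add.commute)
  moreover have "[?E (s2, s0) 0 0 * ?P ^ 2 = ?E (s2, s1) 0 1 + ?P ^ 2 * ?E (s2, s1) 1 1]
      (mod ?P ^ 3)"
    using entries[of "(s2, s0)" "(s2, s1)" "[[1, ?P ^ 2]]" "[[1, ?P ^ 2]]" 0 1]
    by (simp add: arrows) (simp add: sums add.commute)
  moreover have "[?E (s3, s0) 0 0 * ?P = ?E (s3, s1) 0 1 + ?P * ?E (s3, s1) 1 1] (mod ?P ^ 3)"
    using entries[of "(s3, s0)" "(s3, s1)" "[[1, ?P]]" "[[1, ?P]]" 0 1]
    by (simp add: arrows) (simp add: sums add.commute)
  moreover have "[?E (s2, s1) 0 1 = ?P * ?E (s3, s1) 0 1] (mod ?P ^ 4)"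
    using entries[of "(s2, s1)" "(s3, s1)" "[[?P, 0], [0, 1]]" "[[?P, 0], [1, 1]]" 0 1]
    by (simp add: arrows) (simp add: sums add.commute)
  \<comment> \<open>The modulus is p because min (6-5) 2 = 1. The summand without the factor p comes
    from the additional entry 1 in the second octahedron.\<close>
  moreover have "[?E (s2, s1) 1 0 * ?P + ?E (s2, s1) 1 1 = ?E (s3, s1) 1 0] (mod ?P)"
    using entries[of "(s2, s1)" "(s3, s1)" "[[?P, 0], [0, 1]]" "[[?P, 0], [1, 1]]" 1 0]
    by (simp add: arrows) (simp add: sums add.commute)
  moreover have "[?E (s3, s1) 1 1 - ?E (s3, s1) 1 0 * ?P = ?E (s0', s1) 0 0] (mod ?P ^ 2)"
    using entries[of "(s3, s1)" "(s0', s1)" "[[- ?P], [1]]" "[[- ?P], [1]]" 1 0]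
    by (simp add: arrows) (simp add: sums add.commute)
  moreover have "prime ?P"
    using p by simp
  ultimately show False
    using entries_contradiction by blast
qed

section \<open>The two non-isomorphism claims\<close>

lemma oct_step_in_carrier: "0 < p \<Longrightarrow> oct_step p U V x y v \<in> carrier (CMod p (oct_ob y))"
  unfolding oct_step_def zero_mor_def
  by (auto split: option.split intro: mat_mor_in_carrier zero_in_carrier)

lemma Region_subset_Sharp: "Region n \<subseteq> Sharp n"
  by (auto simp: Region_def)

lemma agree_on_used_arrows:
  assumes "agree_on p 6 (Region 3) X D" "Ob D = oct_ob"
  shows "x \<in> Region 3 \<Longrightarrow> Ob X x = oct_ob x"
    and "(x, y) \<in> used_arrows \<Longrightarrow> stab_eq p 6 (oct_ob x) (oct_ob y) (Ar X x y) (Ar D x y)"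
  using assms used_arrows_Region[of x y] unfolding agree_on_def by metis+

theorem lemma3p2:
  fixes p :: nat
  assumes "prime p"
  shows "(\<forall>X X'. periodic_pretriangle p 6 3 X \<and> agree_on p 6 (Region 3) X (octX p) \<and>
                 periodic_pretriangle p 6 3 X' \<and> agree_on p 6 (Region 3) X' (octXt p) \<longrightarrow>
                 \<not> periodic_isomorphic p 6 3 X X') \<and>
         \<not> (\<exists>f. iso_on p 6 (Region 3) (octX p) (octXt p) f \<and>
                (\<forall>i\<in>{1, 2, 3}.
                   stab_eq p 6 (Ob (octX p) (Sym 0 1, Sym i 0)) (Ob (octXt p) (Sym 0 1, Sym i 0))
                     (f (Sym 0 1, Sym i 0))
                     (shift_mor p (Ob (octX p) (Sym i 0, Sym 0 0)) (Ob (octXt p) (Sym i 0, Sym 0 0))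
                       (f (Sym i 0, Sym 0 0)))))"
proof (intro conjI allI impI notI)
  fix X X'
  assume "periodic_pretriangle p 6 3 X \<and> agree_on p 6 (Region 3) X (octX p) \<and>
    periodic_pretriangle p 6 3 X' \<and> agree_on p 6 (Region 3) X' (octXt p)"
  then have agree: "agree_on p 6 (Region 3) X (octX p)" "agree_on p 6 (Region 3) X' (octXt p)"
    by auto
  assume "periodic_isomorphic p 6 3 X X'"
  then obtain f g where f: "periodic_morphism p 6 3 X X' f" and g: "periodic_morphism p 6 3 X' X g"
    and gf: "\<And>x. x \<in> Sharp 3 \<Longrightarrow> stab_eq p 6 (Ob X x) (Ob X x) (g x \<circ> f x) id"
    unfolding periodic_isomorphic_def by blast
  note ob = agree_on_used_arrows(1)[OF agree(1) Ob_oct(1)]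
    agree_on_used_arrows(1)[OF agree(2) Ob_oct(2)]
  have Reg: "(s1, s0) \<in> Region 3" "(s2, s0) \<in> Region 3" "(s0', s1) \<in> Region 3"
    by (simp_all add: Region_def Sharp_def Delta_def)
  then have Sharp: "(s1, s0) \<in> Sharp 3" "(s2, s0) \<in> Sharp 3"
    using Region_subset_Sharp by blast+
  have "natural_on p 6 (Region 3) X X' f"
    using f Region_subset_Sharp[of 3] unfolding periodic_morphism_def natural_on_def by blast
  moreover have "g (s2, s0) \<in> lin p 6 (oct_ob (s2, s0)) (oct_ob (s2, s0))"
    using g Sharp(2) ob[OF Reg(2)] unfolding periodic_morphism_def natural_on_def by metis
  moreover have "stab_eq p 6 (oct_ob (s2, s0)) (oct_ob (s2, s0)) (g (s2, s0) \<circ> f (s2, s0)) id"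
    using gf[OF Sharp(2)] ob[OF Reg(2)] by simp
  moreover have "stab_eq p 6 (oct_ob (s0', s1)) (oct_ob (s0', s1)) (f (s0', s1))
      (shift_mor p (oct_ob (s1, s0)) (oct_ob (s1, s0)) (f (s1, s0)))"
  proof -
    \<comment> \<open>Periodicity of \<open>f\<close> at 1/0 is thus the required condition.\<close>
    have "qshift (s1, s0) = (s0', s1)"
      by (simp add: qshift_def)
    then show ?thesis
      using f Sharp(1) ob[OF Reg(1)] ob[OF Reg(3)] unfolding periodic_morphism_def by metis
  qed
  ultimately show False
    using no_shift_compatible_iso[OF assms ob
        agree_on_used_arrows(2)[OF agree(1) Ob_oct(1)] agree_on_used_arrows(2)[OF agree(2) Ob_oct(2)]]
    by blast
next
  assume "\<exists>f. iso_on p 6 (Region 3) (octX p) (octXt p) f \<and>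
    (\<forall>i\<in>{1, 2, 3}.
       stab_eq p 6 (Ob (octX p) (Sym 0 1, Sym i 0)) (Ob (octXt p) (Sym 0 1, Sym i 0))
         (f (Sym 0 1, Sym i 0))
         (shift_mor p (Ob (octX p) (Sym i 0, Sym 0 0)) (Ob (octXt p) (Sym i 0, Sym 0 0))
           (f (Sym i 0, Sym 0 0))))"
  then obtain f where iso: "iso_on p 6 (Region 3) (octX p) (octXt p) f"
    and shift: "stab_eq p 6 (oct_ob (s0', s1)) (oct_ob (s0', s1)) (f (s0', s1))
      (shift_mor p (oct_ob (s1, s0)) (oct_ob (s1, s0)) (f (s1, s0)))"
    unfolding Ob_oct by blast
  have "(s2, s0) \<in> Region 3"
    by (simp add: Region_def Sharp_def Delta_def)
  then obtain g where g: "g \<in> lin p 6 (oct_ob (s2, s0)) (oct_ob (s2, s0))"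
      "stab_eq p 6 (oct_ob (s2, s0)) (oct_ob (s2, s0)) (g \<circ> f (s2, s0)) id"
    using iso unfolding iso_on_def stab_iso_def Ob_oct by blast
  \<comment> \<open>The diagrams are now the octahedra themselves, so agreement with them is
    reflexivity of stable equality.\<close>
  have "stab_eq p 6 (oct_ob x) (oct_ob y) (Ar (oct p U V) x y) (Ar (oct p U V) x y)"
    if "(x, y) \<in> used_arrows" for x y U V
    using oct_step_in_carrier[OF prime_gt_0_nat[OF assms]] Ar_oct[OF that]
    by (intro stab_eq_refl prime_gt_0_nat[OF assms]) simp
  then show False
    using no_shift_compatible_iso[OF assms, of "octX p" "octXt p" f g] iso g shift
    unfolding iso_on_def by (simp add: octX_def octXt_def oct_def)
qed

end
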